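(* Let $\alpha$ be a segmented model, with Alice's command set $A_\alpha=\{0,1\}$, state vectors $|v_\alpha(0)\rangle,|v_\alpha(1)\rangle$, Eve's command set $E_\alpha$, and detection operators $M_\alpha(b_E;j_E)$, and let $r$ be a real number with $0\le r<1$. Then there exists a segmented model $\beta$ with $A_\beta=A_\alpha=\{0,1\}$, $E_\beta\supseteq E_\alpha$ and the same set of possible outcomes of Eve's measurements, such that $$\Pr\nolimits_\beta(j_E\mid b_A,b_E)=\Pr\nolimits_\alpha(j_E\mid b_A,b_E)\quad\text{for all } b_A\in A_\alpha,\ b_E\in E_\alpha \text{ and all outcomes } j_E,$$ and $$|\langle v_\beta(0)|v_\beta(1)\rangle| = r\,|\langle v_\alpha(0)|v_\alpha(1)\rangle|.$$
   Context: A segmented model $\mu$ (of Alice transmitting to an eavesdropper Eve) consists of: a set of Alice's commands $A_\mu=\{0,1\}$; a complex Hilbert space $\mathcal{H}_\mu$; a function assigning to each command $b_A\in A_\mu$ a unit vector $|v_\mu(b_A)\rangle\in\mathcal{H}_\mu$; a set $E_\mu$ of Eve's commands; a set $J_\mu$ of possible outcomes (a set of natural numbers); and, for each $b_E\in E_\mu$, a positive operator valued measure (POVM) on $\mathcal{H}_\mu$ with detection operators $M_\mu(b_E;j_E)$, $j_E\in J_\mu$, meaning that each $M_\mu(b_E;j_E)$ is a self-adjoint positive semidefinite bounded operator on $\mathcal{H}_\mu$ and $\sum_{j_E\in J_\mu} M_\mu(b_E;j_E)=\mathbf{1}$ (strong operator convergence if the sum is infinite). The model asserts the conditional probabilities $$\Pr\nolimits_\mu(j_E\mid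 b_A,b_E)=\langle v_\mu(b_A)|M_\mu(b_E;j_E)|v_\mu(b_A)\rangle.$$ *)

theory Defs
  imports "HOL-Analysis.Analysis" "HOL-Algebra.Module"
begin

definition complex_ring :: "complex ring"
  where "complex_ring = \<lparr>carrier = UNIV, mult = (*), one = 1, zero = 0, add = (+)\<rparr>"

text \<open>
  Hilbert spaces are given by an explicit carrier set, so that the space is a component of a
  model rather than a type, and existence of a model needs no quantification over types.
  The fields \<open>mult\<close> and \<open>one\<close> that \<open>module\<close> inherits from \<open>ring\<close> are unused.
\<close>

record 'h inner_space = "(complex, 'h) module" +
  cinner :: "'h \<Rightarrow> 'h \<Rightarrow> complex"

definition hnorm :: "('h, 'm) inner_space_scheme \<Rightarrow> 'h \<Rightarrow> real"
  where "hnorm H x = sqrt (Re (cinner H x x))"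

definition hdist :: "('h, 'm) inner_space_scheme \<Rightarrow> 'h \<Rightarrow> 'h \<Rightarrow> real"
  where "hdist H x y = hnorm H (x \<ominus>\<^bsub>H\<^esub> y)"

text \<open>The inner product is linear in its second argument (Dirac convention).\<close>

locale complex_hilbert_space = Module.module complex_ring H
  for H :: "('h, 'm) inner_space_scheme" (structure) +
  assumes cinner_add_right:
      "\<lbrakk>x \<in> carrier H; y \<in> carrier H; z \<in> carrier H\<rbrakk>
        \<Longrightarrow> cinner H x (y \<oplus> z) = cinner H x y + cinner H x z"
    and cinner_smult_right:
      "\<lbrakk>x \<in> carrier H; y \<in> carrier H\<rbrakk> \<Longrightarrow> cinner H x (c \<odot> y) = c * cinner H x y"
    and cinner_commute:
      "\<lbrakk>x \<in> carrier H; y \<in> carrier H\<rbrakk> \<Longrightarrow> cinner H y x = cnj (cinner H x y)"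
    and cinner_nonneg: "x \<in> carrier H \<Longrightarrow> cinner H x x \<in> \<real>\<^sub>\<ge>\<^sub>0"
    and cinner_definite: "\<lbrakk>x \<in> carrier H; cinner H x x = 0\<rbrakk> \<Longrightarrow> x = \<zero>"
    and complete: "Metric_space.mcomplete (carrier H) (hdist H)"

definition bounded_operator :: "('h, 'm) inner_space_scheme \<Rightarrow> ('h \<Rightarrow> 'h) \<Rightarrow> bool"
  where "bounded_operator H T \<longleftrightarrow>
    T \<in> carrier H \<rightarrow> carrier H \<and>
    (\<forall>x\<in>carrier H. \<forall>y\<in>carrier H. T (x \<oplus>\<^bsub>H\<^esub> y) = T x \<oplus>\<^bsub>H\<^esub> T y) \<and>
    (\<forall>c. \<forall>x\<in>carrier H. T (c \<odot>\<^bsub>H\<^esub> x) = c \<odot>\<^bsub>H\<^esub> T x) \<and>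
    (\<exists>K. \<forall>x\<in>carrier H. hnorm H (T x) \<le> K * hnorm H x)"

definition selfadjoint_operator :: "('h, 'm) inner_space_scheme \<Rightarrow> ('h \<Rightarrow> 'h) \<Rightarrow> bool"
  where "selfadjoint_operator H T \<longleftrightarrow>
    (\<forall>x\<in>carrier H. \<forall>y\<in>carrier H. cinner H (T x) y = cinner H x (T y))"

definition possemidef_operator :: "('h, 'm) inner_space_scheme \<Rightarrow> ('h \<Rightarrow> 'h) \<Rightarrow> bool"
  where "possemidef_operator H T \<longleftrightarrow> (\<forall>x\<in>carrier H. cinner H x (T x) \<in> \<real>\<^sub>\<ge>\<^sub>0)"

text \<open>
  Strong convergence of \<open>\<Sum>j\<in>J. T j\<close> to the identity: for every vector \<open>x\<close>, the net of finite
  partial sums of \<open>T j x\<close> tends to \<open>x\<close> in norm, the same mode of convergence as in \<open>has_sum\<close>.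
  For finite \<open>J\<close> this says that the finite sum equals \<open>x\<close>.
\<close>

definition strong_sum_identity ::
    "('h, 'm) inner_space_scheme \<Rightarrow> 'j set \<Rightarrow> ('j \<Rightarrow> 'h \<Rightarrow> 'h) \<Rightarrow> bool"
  where "strong_sum_identity H J T \<longleftrightarrow>
    (\<forall>x\<in>carrier H. ((\<lambda>F. hdist H (finsum H (\<lambda>j. T j x) F) x) \<longlongrightarrow> 0) (finite_subsets_at_top J))"

definition povm :: "('h, 'm) inner_space_scheme \<Rightarrow> 'j set \<Rightarrow> ('j \<Rightarrow> 'h \<Rightarrow> 'h) \<Rightarrow> bool"
  where "povm H J T \<longleftrightarrow>
    (\<forall>j\<in>J. bounded_operator H (T j) \<and> selfadjoint_operator H (T j) \<and>
      possemidef_operator H (T j)) \<and>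
    strong_sum_identity H J T"

record ('h, 'e) model =
  alice :: "nat set"
  hilb :: "'h inner_space"
  state :: "nat \<Rightarrow> 'h"
  eve :: "'e set"
  outcomes :: "nat set"
  detection :: "'e \<Rightarrow> nat \<Rightarrow> 'h \<Rightarrow> 'h"

definition segmented_model :: "('h, 'e) model \<Rightarrow> bool"
  where "segmented_model \<mu> \<longleftrightarrow>
    alice \<mu> = {0, 1} \<and>
    complex_hilbert_space (hilb \<mu>) \<and>
    (\<forall>b\<in>alice \<mu>. state \<mu> b \<in> carrier (hilb \<mu>) \<and> hnorm (hilb \<mu>) (state \<mu> b) = 1) \<and>
    (\<forall>e\<in>eve \<mu>. povm (hilb \<mu>) (outcomes \<mu>) (detection \<mu> e))"

text \<open>
  The inner product below is real in every segmented model since the detection operators are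
  positive, so taking the real part loses nothing.
\<close>

definition pr :: "('h, 'e) model \<Rightarrow> nat \<Rightarrow> nat \<Rightarrow> 'e \<Rightarrow> real"
  where "pr \<mu> j a e = Re (cinner (hilb \<mu>) (state \<mu> a) (detection \<mu> e j (state \<mu> a)))"

end

theory Submission
  imports Defs
begin

text \<open>
  Put \<open>s = \<langle>v\<^sub>0|v\<^sub>1\<rangle>\<close> and give Alice an extra qubit carrying unit vectors \<open>u\<^sub>0, u\<^sub>1\<close> with overlap
  \<open>r\<close>: the states \<open>v\<^sub>a \<otimes> u\<^sub>a\<close> have overlap \<open>r s\<close>, and the operators \<open>M \<otimes> 1\<close> give the old
  probabilities. Only the span of \<open>v\<^sub>0 \<otimes> u\<^sub>0\<close> and \<open>v\<^sub>1 \<otimes> u\<^sub>1\<close> matters, so the operators can be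
  compressed to \<open>V\<^sup>* (M \<otimes> 1) V\<close> for an isometry \<open>V\<close> from \<open>\<complex>\<^sup>2\<close> onto that span. The resulting model
  lives on \<open>\<complex>\<^sup>2\<close>, which is moved into the given type of vectors along an injection; one exists since
  that type contains a complex line and \<open>\<complex>\<^sup>2\<close> is equipotent to \<open>\<complex>\<close>.

  A direct construction on \<open>H \<oplus> H\<close> would have to use the completeness of \<open>H\<close>. This is a pitfall:
  \<open>Metric_space\<close> constrains the distance off the carrier too, where \<open>hdist\<close> may take junk values,
  and without \<open>Metric_space\<close> nothing can be derived from \<open>mcomplete\<close>.
\<close>

section \<open>The Hilbert space C^2 and its transport along an injection\<close>

definition cprod_inner :: "complex \<times> complex \<Rightarrow> complex \<times> complex \<Rightarrow> complex"
  where "cprod_inner x y = cnj (fst x) * fst y + cnj (snd x) * snd y"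

definition cprod_scale :: "complex \<Rightarrow> complex \<times> complex \<Rightarrow> complex \<times> complex"
  where "cprod_scale c x = (c * fst x, c * snd x)"

lemma cprod_inner_self: "cprod_inner x x = of_real ((norm x)\<^sup>2)"
  unfolding cprod_inner_def norm_prod_def
  by (simp add: complex_norm_square[symmetric] mult.commute)

lemma cprod_inner_add_right: "cprod_inner x (y + z) = cprod_inner x y + cprod_inner x z"
  by (simp add: cprod_inner_def algebra_simps)

lemma cprod_inner_scale_right: "cprod_inner x (cprod_scale c y) = c * cprod_inner x y"
  by (simp add: cprod_inner_def cprod_scale_def algebra_simps)

lemma cprod_inner_commute: "cprod_inner y x = cnj (cprod_inner x y)"
  by (simp add: cprod_inner_def)

lemma cring_complex_ring: "cring complex_ring"
proof (rule cringI)
  show "abelian_group complex_ring"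
    by (rule abelian_groupI) (auto simp: complex_ring_def algebra_simps intro: exI[of _ "- x" for x])
  show "Group.comm_monoid complex_ring"
    by (rule comm_monoidI) (auto simp: complex_ring_def)
qed (auto simp: complex_ring_def algebra_simps)

abbreviation coord :: "(complex \<times> complex \<Rightarrow> 'h) \<Rightarrow> 'h \<Rightarrow> complex \<times> complex"
  where "coord \<phi> \<equiv> inv_into UNIV \<phi>"

definition plane :: "(complex \<times> complex \<Rightarrow> 'h) \<Rightarrow> 'h inner_space"
  where "plane \<phi> = \<lparr>carrier = range \<phi>, mult = undefined, one = undefined, zero = \<phi> 0,
    add = (\<lambda>x y. \<phi> (coord \<phi> x + coord \<phi> y)), smult = (\<lambda>c x. \<phi> (cprod_scale c (coord \<phi> x))),
    cinner = (\<lambda>x y. cprod_inner (coord \<phi> x) (coord \<phi> y))\<rparr>"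

lemma plane_simps [simp]:
  "carrier (plane \<phi>) = range \<phi>"
  "zero (plane \<phi>) = \<phi> 0"
  "add (plane \<phi>) x y = \<phi> (coord \<phi> x + coord \<phi> y)"
  "smult (plane \<phi>) c x = \<phi> (cprod_scale c (coord \<phi> x))"
  "cinner (plane \<phi>) x y = cprod_inner (coord \<phi> x) (coord \<phi> y)"
  by (simp_all add: plane_def)

lemma hnorm_plane: "hnorm (plane \<phi>) x = norm (coord \<phi> x)"
  by (simp add: hnorm_def cprod_inner_self)

context
  fixes \<phi> :: "complex \<times> complex \<Rightarrow> 'h"
  assumes inj: "inj \<phi>"
begin

text \<open>The description that defines the inverse sees \<open>x\<close> only through
  \<open>coord \<phi> x\<close>, so the formula holds off \<open>range \<phi>\<close> as
  well.\<close>

lemma a_inv_plane: "a_inv (plane \<phi>) x = \<phi> (- coord \<phi> x)"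
proof -
  have "(THE y. y \<in> range \<phi> \<and> \<phi> (coord \<phi> x + coord \<phi> y) = \<phi> 0 \<and>
      \<phi> (coord \<phi> y + coord \<phi> x) = \<phi> 0) = \<phi> (- coord \<phi> x)"
    by (rule the_equality)
      (use inj in \<open>auto simp: inj_eq add_eq_0_iff2 add.commute minus_equation_iff[of "coord \<phi> x"]\<close>)
  then show ?thesis
    by (simp add: a_inv_def m_inv_def)
qed

lemma hdist_plane: "hdist (plane \<phi>) x y = dist (coord \<phi> x) (coord \<phi> y)"
  by (simp add: hdist_def a_minus_def hnorm_plane a_inv_plane inj dist_norm)

lemma abelian_group_plane: "abelian_group (plane \<phi>)"
proof (rule abelian_groupI)
  fix x assume "x \<in> carrier (plane \<phi>)"
  then show "\<exists>y\<in>carrier (plane \<phi>). y \<oplus>\<^bsub>plane \<phi>\<^esub> x = \<zero>\<^bsub>plane \<phi>\<^esub>"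
    by (intro bexI[of _ "\<phi> (- coord \<phi> x)"]) (auto simp: inj)
qed (auto simp: inj algebra_simps)

lemma complex_hilbert_space_plane: "complex_hilbert_space (plane \<phi>)"
proof -
  \<comment> \<open>Nonnegativity and symmetry are demanded for all arguments, even off the carrier.
    They hold because \<open>coord \<phi>\<close> is total and \<open>hdist_plane\<close> is
    unconditional.\<close>
  interpret M: Metric_space "range \<phi>" "hdist (plane \<phi>)"
    by unfold_locales (auto simp: hdist_plane inj dist_commute dist_triangle)
  have "M.mcomplete"
    unfolding M.mcomplete_def
  proof (intro allI impI)
    fix \<sigma> assume \<sigma>: "M.MCauchy \<sigma>"
    then have "Cauchy (coord \<phi> \<circ> \<sigma>)"
      by (simp add: M.MCauchy_def Cauchy_def hdist_plane)
    then obtain l where l: "(coord \<phi> \<circ> \<sigma>) \<longlonglongrightarrow> l"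
      using Cauchy_convergent convergent_def by blast
    moreover have "\<sigma> i \<in> range \<phi>" for i
      using \<sigma> unfolding M.MCauchy_def by blast
    ultimately have "limitin M.mtopology \<sigma> (\<phi> l) sequentially"
      by (simp add: M.limit_metric_sequentially hdist_plane inj lim_sequentially)
    then show "\<exists>x. limitin M.mtopology \<sigma> x sequentially" ..
  qed
  moreover have "Module.module complex_ring (plane \<phi>)"
    by (rule moduleI[OF cring_complex_ring abelian_group_plane])
      (auto simp: inj complex_ring_def cprod_scale_def algebra_simps)
  ultimately show ?thesis
    by (intro complex_hilbert_space.intro complex_hilbert_space_axioms.intro)
      (auto simp: inj cprod_inner_add_right cprod_inner_scale_right cprod_inner_self
        intro: cprod_inner_commute)
qed

lemma finsum_plane:
  assumes "finite F" and "\<And>j. j \<in> F \<Longrightarrow> f j \<in> range \<phi>"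
  shows "finsum (plane \<phi>) f F = \<phi> (\<Sum>j\<in>F. coord \<phi> (f j))"
proof -
  interpret abelian_group "plane \<phi>" by (rule abelian_group_plane)
  show ?thesis using assms by (induction F rule: finite_induct) (auto simp: inj Pi_def)
qed

end

text \<open>An infinite set is equipotent to its square. No linearity is asked of the injection,
  since \<open>plane\<close> carries all the structure over.\<close>

lemma ex_inj_cprod:
  assumes "inj (h :: complex \<Rightarrow> 'h)"
  shows "\<exists>\<phi> :: complex \<times> complex \<Rightarrow> 'h. inj \<phi>"
proof -
  obtain g :: "complex \<times> complex \<Rightarrow> complex" where "inj g"
    using card_of_Times_same_infinite[of "UNIV :: complex set"] infinite_UNIV_char_0[where 'a = complex]
    unfolding card_of_ordIso[symmetric] bij_betw_def by auto
  with assms have "inj (h \<circ> g)" by (intro inj_compose)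
  then show ?thesis by blast
qed

section \<open>Inner product calculus, Cauchy-Schwarz and weak convergence\<close>

context complex_hilbert_space
begin

lemma smult_mem [simp]: "x \<in> carrier H \<Longrightarrow> c \<odot> x \<in> carrier H"
  by (rule smult_closed) (simp add: complex_ring_def)

lemma cinner_add_left:
  assumes "x \<in> carrier H" "y \<in> carrier H" "z \<in> carrier H"
  shows "cinner H (x \<oplus> y) z = cinner H x z + cinner H y z"
  using assms by (metis M.a_closed cinner_add_right cinner_commute complex_cnj_add)

lemma cinner_smult_left:
  assumes "x \<in> carrier H" "y \<in> carrier H"
  shows "cinner H (c \<odot> x) y = cnj c * cinner H x y"
  using assms by (metis cinner_smult_right cinner_commute complex_cnj_mult smult_mem)

lemma cinner_zero_right: "x \<in> carrier H \<Longrightarrow> cinner H x \<zero> = 0"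
  using cinner_add_right[of x \<zero> \<zero>] by simp

lemma cinner_minus_right:
  assumes "x \<in> carrier H" "y \<in> carrier H" "z \<in> carrier H"
  shows "cinner H x (y \<ominus> z) = cinner H x y - cinner H x z"
proof -
  have "cinner H x (\<ominus> z) + cinner H x z = 0"
    using assms by (simp add: cinner_add_right[symmetric] M.l_neg cinner_zero_right)
  then show ?thesis
    using assms by (simp add: a_minus_def cinner_add_right eq_neg_iff_add_eq_0)
qed

lemma cinner_finsum_right:
  assumes "finite F" "x \<in> carrier H" "f \<in> F \<rightarrow> carrier H"
  shows "cinner H x (finsum H f F) = (\<Sum>j\<in>F. cinner H x (f j))"
  using assms
  by (induction F rule: finite_induct) (auto simp: cinner_zero_right cinner_add_right Pi_def)

lemma cinner_self: "x \<in> carrier H \<Longrightarrow> cinner H x x = of_real ((hnorm H x)\<^sup>2)"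
  using cinner_nonneg[of x] by (auto simp: hnorm_def nonneg_Reals_def complex_nonneg_Reals_iff complex_eq_iff)

lemma Cauchy_Schwarz:
  assumes x: "x \<in> carrier H" and y: "y \<in> carrier H"
  shows "cmod (cinner H x y) \<le> hnorm H x * hnorm H y"
proof (cases "y = \<zero>")
  case True
  then show ?thesis using x by (simp add: cinner_zero_right hnorm_def)
next
  case False
  define N where "N = (hnorm H y)\<^sup>2"
  have yy: "cinner H y y = of_real N" using y by (simp add: N_def cinner_self)
  then have "N > 0" using False y cinner_definite[of y] by (auto simp: N_def)
  define c where "c = cinner H y x"
  \<comment> \<open>This is the component of \<open>x\<close> orthogonal to \<open>y\<close>,
    multiplied by \<open>N\<close> to avoid division; the inequality is the nonnegativity of its
    square norm.\<close>
  define z where "z = of_real N \<odot> x \<oplus> (- c) \<odot> y"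
  have z: "z \<in> carrier H" using x y by (simp add: z_def)
  have c': "cinner H x y = cnj c" using x y cinner_commute unfolding c_def by blast
  have "cinner H z z = of_real N * (of_real N * of_real ((hnorm H x)\<^sup>2) - c * cnj c)"
    using x y unfolding z_def
    by (simp add: cinner_add_left cinner_add_right cinner_smult_left cinner_smult_right
        cinner_self[of x] yy c_def[symmetric] c' algebra_simps)
  also have "\<dots> = of_real (N * (N * (hnorm H x)\<^sup>2 - (cmod c)\<^sup>2))"
    by (simp add: complex_norm_square[symmetric])
  finally have "N * (N * (hnorm H x)\<^sup>2 - (cmod c)\<^sup>2) \<ge> 0"
    using cinner_nonneg[OF z] by (simp only: nonneg_Reals_of_real_iff)
  with \<open>N > 0\<close> have "(cmod c)\<^sup>2 \<le> (hnorm H x * hnorm H y)\<^sup>2"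
    by (simp add: zero_le_mult_iff N_def power_mult_distrib mult.commute)
  moreover have "hnorm H x * hnorm H y \<ge> 0"
    using x y cinner_nonneg by (auto simp: hnorm_def complex_nonneg_Reals_iff)
  ultimately show ?thesis
    by (simp add: c' power2_le_iff_abs_le)
qed

text \<open>Pairing with the unit vector \<open>x\<close> recovers the scalar. This supplies the
  complex line needed for \<open>ex_inj_cprod\<close>.\<close>

lemma inj_smult:
  assumes "x \<in> carrier H" "hnorm H x = 1"
  shows "inj (\<lambda>c. c \<odot> x)"
proof (rule injI)
  fix c d assume "c \<odot> x = d \<odot> x"
  then have "cinner H x (c \<odot> x) = cinner H x (d \<odot> x)" by simp
  then show "c = d" using assms by (simp add: cinner_smult_right cinner_self)
qed

text \<open>Strong convergence implies weak convergence: by Cauchy-Schwarz the error of a partial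
  sum is at most \<open>hnorm H x\<close> times its distance to \<open>y\<close>.\<close>

lemma povm_sum_tendsto:
  assumes "povm H J T" "x \<in> carrier H" "y \<in> carrier H"
  shows "((\<lambda>j. cinner H x (T j y)) has_sum cinner H x y) J"
proof -
  have T: "T j y \<in> carrier H" if "j \<in> J" for j
    using assms that by (auto simp: povm_def bounded_operator_def)
  have "((\<lambda>F. hnorm H x * hdist H (finsum H (\<lambda>j. T j y) F) y) \<longlongrightarrow> hnorm H x * 0)
      (finite_subsets_at_top J)"
    using assms by (intro tendsto_mult tendsto_const) (auto simp: povm_def strong_sum_identity_def)
  then have "((\<lambda>F. hnorm H x * hdist H (finsum H (\<lambda>j. T j y) F) y) \<longlongrightarrow> 0)
      (finite_subsets_at_top J)" by simp
  moreover have "\<forall>\<^sub>F F in finite_subsets_at_top J.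
      norm ((\<Sum>j\<in>F. cinner H x (T j y)) - cinner H x y) \<le>
        hnorm H x * hdist H (finsum H (\<lambda>j. T j y) F) y"
  proof (rule eventually_finite_subsets_at_top_weakI)
    fix F assume F: "finite F" "F \<subseteq> J"
    then have cl: "(\<lambda>j. T j y) \<in> F \<rightarrow> carrier H" using T by auto
    then have "finsum H (\<lambda>j. T j y) F \<in> carrier H" by (rule M.finsum_closed)
    then show "norm ((\<Sum>j\<in>F. cinner H x (T j y)) - cinner H x y) \<le>
        hnorm H x * hdist H (finsum H (\<lambda>j. T j y) F) y"
      using Cauchy_Schwarz[of x "finsum H (\<lambda>j. T j y) F \<ominus> y"] assms F cl
      by (simp add: hdist_def cinner_minus_right cinner_finsum_right)
  qed
  ultimately have "((\<lambda>F. (\<Sum>j\<in>F. cinner H x (T j y)) - cinner H x y) \<longlongrightarrow> 0)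
      (finite_subsets_at_top J)"
    by (rule Lim_null_comparison[rotated])
  then show ?thesis
    unfolding has_sum_def by (simp add: LIM_zero_iff)
qed

lemma smult_add_left: "x \<in> carrier H \<Longrightarrow> (c + d) \<odot> x = c \<odot> x \<oplus> d \<odot> x"
  using smult_l_distr[of c d x] by (simp add: complex_ring_def)

lemma smult_add_right:
  "x \<in> carrier H \<Longrightarrow> y \<in> carrier H \<Longrightarrow> c \<odot> (x \<oplus> y) = c \<odot> x \<oplus> c \<odot> y"
  by (rule smult_r_distr) (simp_all add: complex_ring_def)

lemma smult_mult: "x \<in> carrier H \<Longrightarrow> (c * d) \<odot> x = c \<odot> (d \<odot> x)"
  using smult_assoc1[of c d x] by (simp add: complex_ring_def)

lemma smult_zero_left: "x \<in> carrier H \<Longrightarrow> 0 \<odot> x = \<zero>"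
  using smult_l_null[of x] by (simp add: complex_ring_def)

lemma smult_one_left: "x \<in> carrier H \<Longrightarrow> 1 \<odot> x = x"
  using smult_one[of x] by (simp add: complex_ring_def)

lemma cinner_zero_left: "x \<in> carrier H \<Longrightarrow> cinner H \<zero> x = 0"
  using cinner_commute[of x \<zero>] by (simp add: cinner_zero_right)

end

section \<open>Compression of operators and POVMs to C^2\<close>

lemma bounded_operator_closed:
  "bounded_operator H T \<Longrightarrow> x \<in> carrier H \<Longrightarrow> T x \<in> carrier H"
  by (auto simp: bounded_operator_def)

lemma bounded_operator_add:
  "bounded_operator H T \<Longrightarrow> x \<in> carrier H \<Longrightarrow> y \<in> carrier H \<Longrightarrow>
    T (x \<oplus>\<^bsub>H\<^esub> y) = T x \<oplus>\<^bsub>H\<^esub> T y"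
  by (auto simp: bounded_operator_def)

lemma bounded_operator_smult:
  "bounded_operator H T \<Longrightarrow> x \<in> carrier H \<Longrightarrow> T (c \<odot>\<^bsub>H\<^esub> x) = c \<odot>\<^bsub>H\<^esub> T x"
  by (auto simp: bounded_operator_def)

text \<open>\<open>p\<close> and \<open>q\<close> are the components of an isometry \<open>V\<close> from \<open>\<complex>\<^sup>2\<close> to \<open>H \<oplus> H\<close>, which
  stands for \<open>H \<otimes> \<complex>\<^sup>2\<close>; \<open>compression T\<close> is then \<open>V\<^sup>* (T \<oplus> T) V\<close>.\<close>

locale doubled_isometry = complex_hilbert_space H
  for H :: "'h inner_space" (structure) +
  fixes p q :: "complex \<times> complex \<Rightarrow> 'h"
  assumes closed [simp]: "p x \<in> carrier H" "q x \<in> carrier H"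
    and add: "p (x + y) = p x \<oplus> p y" "q (x + y) = q x \<oplus> q y"
    and scale: "p (cprod_scale c x) = c \<odot> p x" "q (cprod_scale c x) = c \<odot> q x"
    and isometry: "cinner H (p x) (p y) + cinner H (q x) (q y) = cprod_inner x y"
begin

text \<open>The sesquilinear form of the compressed operator: \<open>V x\<close> paired with the
  image of \<open>V y\<close> under \<open>T\<close> acting on both components. Working with it
  avoids constructing the adjoint of \<open>V\<close>.\<close>

definition form :: "('h \<Rightarrow> 'h) \<Rightarrow> complex \<times> complex \<Rightarrow> complex \<times> complex \<Rightarrow> complex"
  where "form T x y = cinner H (p x) (T (p y)) + cinner H (q x) (T (q y))"

definition compression :: "('h \<Rightarrow> 'h) \<Rightarrow> complex \<times> complex \<Rightarrow> complex \<times> complex"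
  where "compression T x = (form T (1, 0) x, form T (0, 1) x)"

context
  fixes T :: "'h \<Rightarrow> 'h"
  assumes T: "bounded_operator H T"
begin

lemma form_add_right: "form T x (y + z) = form T x y + form T x z"
  by (simp add: form_def add bounded_operator_add[OF T] bounded_operator_closed[OF T] cinner_add_right)

lemma form_scale_right: "form T x (cprod_scale c y) = c * form T x y"
  by (simp add: form_def scale bounded_operator_smult[OF T] bounded_operator_closed[OF T]
      cinner_smult_right distrib_left)

lemma form_add_left: "form T (x + y) z = form T x z + form T y z"
  by (simp add: form_def add bounded_operator_closed[OF T] cinner_add_left)

lemma form_scale_left: "form T (cprod_scale c x) y = cnj c * form T x y"
  by (simp add: form_def scale bounded_operator_closed[OF T] cinner_smult_left distrib_left)

lemma compression_add: "compression T (x + y) = compression T x + compression T y"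
  by (simp add: compression_def form_add_right)

lemma compression_scale: "compression T (cprod_scale c x) = cprod_scale c (compression T x)"
  by (simp add: compression_def form_scale_right) (simp add: cprod_scale_def)

text \<open>Expand \<open>x\<close> in the standard basis, the form being conjugate-linear there.
  Symmetry, positivity and probabilities can then be read off from \<open>form\<close>.\<close>

lemma cprod_inner_compression: "cprod_inner x (compression T y) = form T x y"
proof -
  have "form T x y = form T (cprod_scale (fst x) (1, 0) + cprod_scale (snd x) (0, 1)) y"
    by (simp add: cprod_scale_def)
  then show ?thesis
    unfolding form_add_left form_scale_left by (simp add: cprod_inner_def compression_def)
qed

lemma bounded_operator_compression:
  assumes "inj \<phi>"
  shows "bounded_operator (plane \<phi>) (\<lambda>x. \<phi> (compression T (coord \<phi> x)))"
proof -
  \<comment> \<open>Real linearity is what \<open>linear_bounded\<close> asks for; boundedness is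
    then automatic in finite dimension.\<close>
  have "compression T (c *\<^sub>R x) = c *\<^sub>R compression T x" for c x
    using compression_scale[of "of_real c" x]
    by (simp add: cprod_scale_def scaleR_prod_def scaleR_conv_of_real)
  then have "linear (compression T)"
    by (intro linearI compression_add)
  then obtain K where "\<And>x. norm (compression T x) \<le> K * norm x"
    using linear_bounded by blast
  then show ?thesis
    using assms
    by (auto simp: bounded_operator_def hnorm_plane compression_add compression_scale)
qed

lemma selfadjoint_operator_compression:
  assumes "inj \<phi>" and "selfadjoint_operator H T"
  shows "selfadjoint_operator (plane \<phi>) (\<lambda>x. \<phi> (compression T (coord \<phi> x)))"
proof -
  have "cnj (cinner H u (T w)) = cinner H w (T u)" if "u \<in> carrier H" "w \<in> carrier H" for u w
    using that assms(2) cinner_commute[of u "T w"] bounded_operator_closed[OF T]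
    by (simp add: selfadjoint_operator_def)
  then have "cnj (form T x y) = form T y x" for x y
    by (simp add: form_def)
  then have "cprod_inner (compression T x) y = cprod_inner x (compression T y)" for x y
    by (subst cprod_inner_commute) (simp add: cprod_inner_compression)
  then show ?thesis
    using assms(1) by (simp add: selfadjoint_operator_def)
qed

lemma possemidef_operator_compression:
  assumes "inj \<phi>" and "possemidef_operator H T"
  shows "possemidef_operator (plane \<phi>) (\<lambda>x. \<phi> (compression T (coord \<phi> x)))"
  using assms
  by (simp add: possemidef_operator_def cprod_inner_compression form_def)

end

text \<open>Norm convergence in C^2 is coordinatewise, and the coordinates are matrix elements of
  \<open>T j\<close>, so the weak sums in \<open>H\<close> suffice; \<open>isometry\<close>
  identifies their limit.\<close>

lemma povm_compression:
  assumes inj: "inj \<phi>" and T: "povm H J T"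
  shows "povm (plane \<phi>) J (\<lambda>j x. \<phi> (compression (T j) (coord \<phi> x)))"
proof -
  have "((\<lambda>j. form (T j) x y) has_sum cprod_inner x y) J" for x y
    unfolding form_def isometry[symmetric]
    by (intro has_sum_add povm_sum_tendsto[OF T] closed)
  from this[of "(1, 0)"] this[of "(0, 1)"]
  have "((\<lambda>F. (\<Sum>j\<in>F. form (T j) (1, 0) x, \<Sum>j\<in>F. form (T j) (0, 1) x)) \<longlongrightarrow> (fst x, snd x))
      (finite_subsets_at_top J)" for x
    by (intro tendsto_Pair) (simp_all add: has_sum_def cprod_inner_def)
  then have "((\<lambda>F. \<Sum>j\<in>F. compression (T j) x) \<longlongrightarrow> x) (finite_subsets_at_top J)" for x
    by (simp add: compression_def sum_prod)
  then have "((\<lambda>F. dist (\<Sum>j\<in>F. compression (T j) x) x) \<longlongrightarrow> 0) (finite_subsets_at_top J)" for x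
    by (simp add: tendsto_dist_iff[symmetric])
  then have "((\<lambda>F. hdist (plane \<phi>) (finsum (plane \<phi>) (\<lambda>j. \<phi> (compression (T j) (coord \<phi> x))) F) x)
      \<longlongrightarrow> 0) (finite_subsets_at_top J)" for x
    by (rule Lim_transform_eventually, intro eventually_finite_subsets_at_top_weakI)
      (simp add: hdist_plane finsum_plane inj)
  with T inj show ?thesis
    by (simp add: povm_def strong_sum_identity_def bounded_operator_compression
        selfadjoint_operator_compression possemidef_operator_compression)
qed

end

section \<open>Construction of the model with reduced overlap\<close>

theorem proposition1:
  fixes \<alpha> :: "('h, 'e) model" and r :: real
  assumes "segmented_model \<alpha>" and "0 \<le> r" and "r < 1"
  shows "\<exists>\<beta> :: ('h, 'e) model.
    segmented_model \<beta> \<and>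
    alice \<beta> = alice \<alpha> \<and> eve \<alpha> \<subseteq> eve \<beta> \<and> outcomes \<beta> = outcomes \<alpha> \<and>
    (\<forall>a\<in>alice \<alpha>. \<forall>e\<in>eve \<alpha>. \<forall>j\<in>outcomes \<alpha>. pr \<beta> j a e = pr \<alpha> j a e) \<and>
    cmod (cinner (hilb \<beta>) (state \<beta> 0) (state \<beta> 1)) =
      r * cmod (cinner (hilb \<alpha>) (state \<alpha> 0) (state \<alpha> 1))"
proof -
  define H where "H = hilb \<alpha>"
  define v0 where "v0 = state \<alpha> 0"
  define v1 where "v1 = state \<alpha> 1"
  have alice: "alice \<alpha> = {0, 1}"
    and v: "v0 \<in> carrier H" "v1 \<in> carrier H" "hnorm H v0 = 1" "hnorm H v1 = 1"
    and povm: "\<And>e. e \<in> eve \<alpha> \<Longrightarrow> povm H (outcomes \<alpha>) (detection \<alpha> e)"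
    and "complex_hilbert_space H"
    using assms(1) by (auto simp: segmented_model_def H_def v0_def v1_def)
  then interpret complex_hilbert_space H by simp
  define s where "s = cinner H v0 v1"
  have gram: "cinner H v0 v0 = 1" "cinner H v1 v1 = 1" "cinner H v0 v1 = s" "cinner H v1 v0 = cnj s"
    using v cinner_commute[of v0 v1] by (simp_all add: cinner_self s_def)
  have "cmod s \<le> 1"
    using Cauchy_Schwarz[of v0 v1] v by (simp add: s_def)
  then have "r * cmod s < 1"
    using assms by (smt (verit) mult_left_le norm_ge_zero)
  then have rs: "(r * cmod s)\<^sup>2 < 1"
    using assms by (simp add: abs_square_less_1)
  have r1: "r\<^sup>2 \<le> 1" using assms by (simp add: abs_square_le_1)
  \<comment> \<open>Chosen so that \<open>(r s, n)\<close> is a unit vector. It is positive because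
    \<open>r < 1\<close>, which permits the divisions below.\<close>
  define n where "n = sqrt (1 - (r * cmod s)\<^sup>2)"
  have n: "n > 0" "n\<^sup>2 = 1 - (r * cmod s)\<^sup>2" using rs by (simp_all add: n_def)
  \<comment> \<open>The qubit vectors are \<open>(1, 0)\<close> and \<open>(r, t)\<close>, with
    overlap \<open>r\<close>.\<close>
  define t where "t = sqrt (1 - r\<^sup>2)"
  have t: "t\<^sup>2 = 1 - r\<^sup>2" using r1 by (simp add: t_def)
  \<comment> \<open>Gram-Schmidt: subtracting \<open>r s\<close> times \<open>(v0, 0)\<close> from
    \<open>(r v1, t v1)\<close> and dividing by \<open>n\<close> gives
    \<open>(k v1 - k s v0, m v1)\<close>, the image of \<open>(0, 1)\<close>.\<close>
  define k where "k = complex_of_real (r / n)"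
  define m where "m = complex_of_real (t / n)"
  \<comment> \<open>The square norm of the image of \<open>(0, 1)\<close> is 1, as
    \<open>v1 - s v0\<close> has square norm \<open>1 - |s|^2\<close>.\<close>
  have "(r / n)\<^sup>2 * (1 - (cmod s)\<^sup>2) + (t / n)\<^sup>2 = (r\<^sup>2 * (1 - (cmod s)\<^sup>2) + t\<^sup>2) / n\<^sup>2"
    by (simp add: power_divide add_divide_distrib)
  also have "\<dots> = 1" using n t by (simp add: algebra_simps)
  finally have "complex_of_real ((r / n)\<^sup>2 * (1 - (cmod s)\<^sup>2) + (t / n)\<^sup>2) = 1" by simp
  moreover have "complex_of_real ((r / n)\<^sup>2 * (1 - (cmod s)\<^sup>2) + (t / n)\<^sup>2) =
      k * k - k * k * (s * cnj s) + m * m"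
    unfolding k_def m_def complex_norm_square[symmetric]
    by (simp add: power2_eq_square right_diff_distrib)
  ultimately have km: "k * k - k * k * (s * cnj s) + m * m = 1" by simp
  have cnj_km: "cnj k = k" "cnj m = m" by (simp_all add: k_def m_def)
  \<comment> \<open>The isometry sends \<open>(1, 0)\<close> to \<open>(v0, 0)\<close> and \<open>(r s, n)\<close> to \<open>(r v1, t v1)\<close>.\<close>
  define p where "p x = (fst x - k * s * snd x) \<odot>\<^bsub>H\<^esub> v0 \<oplus>\<^bsub>H\<^esub> (k * snd x) \<odot>\<^bsub>H\<^esub> v1" for x
  define q where "q x = (m * snd x) \<odot>\<^bsub>H\<^esub> v1" for x :: "complex \<times> complex"
  interpret doubled_isometry H p q
  proof
    fix x y and c
    have "p x \<oplus>\<^bsub>H\<^esub> p y = (fst x - k * s * snd x + (fst y - k * s * snd y)) \<odot>\<^bsub>H\<^esub> v0 \<oplus>\<^bsub>H\<^esub>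
        (k * snd x + k * snd y) \<odot>\<^bsub>H\<^esub> v1"
      using v unfolding p_def smult_add_left[OF v(1)] smult_add_left[OF v(2)] by (simp add: M.add.m_ac)
    then show "p (x + y) = p x \<oplus>\<^bsub>H\<^esub> p y"
      by (simp add: p_def algebra_simps)
    show "q (x + y) = q x \<oplus>\<^bsub>H\<^esub> q y"
      using v by (simp add: q_def smult_add_left distrib_left)
    have "c \<odot>\<^bsub>H\<^esub> p x = (c * (fst x - k * s * snd x)) \<odot>\<^bsub>H\<^esub> v0 \<oplus>\<^bsub>H\<^esub> (c * (k * snd x)) \<odot>\<^bsub>H\<^esub> v1"
      using v unfolding p_def smult_mult[OF v(1)] smult_mult[OF v(2)] by (simp add: smult_add_right)
    then show "p (cprod_scale c x) = c \<odot>\<^bsub>H\<^esub> p x"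
      by (simp add: p_def cprod_scale_def algebra_simps)
    show "q (cprod_scale c x) = c \<odot>\<^bsub>H\<^esub> q x"
      using v by (simp add: q_def cprod_scale_def smult_mult[symmetric] mult.left_commute)
    have "cinner H (p x) (p y) + cinner H (q x) (q y) =
        cnj (fst x) * fst y + cnj (snd x) * snd y * (k * k - k * k * (s * cnj s) + m * m)"
      using v unfolding p_def q_def
      by (simp add: cinner_add_left cinner_add_right cinner_smult_left cinner_smult_right gram
          cnj_km algebra_simps)
    then show "cinner H (p x) (p y) + cinner H (q x) (q y) = cprod_inner x y"
      by (simp add: km cprod_inner_def)
  qed (use v in \<open>simp_all add: p_def q_def\<close>)
  obtain \<phi> :: "complex \<times> complex \<Rightarrow> 'h" where \<phi>: "inj \<phi>"
    using ex_inj_cprod[OF inj_smult[of v0]] v by blast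
  \<comment> \<open>The coordinates, under the isometry, of the two product states; their inner
    product is visibly \<open>r s\<close>.\<close>
  define w where "w a = (if a = 0 then (1, 0) else (of_real r * s, complex_of_real n))" for a :: nat
  have pq: "p (w 0) = v0" "q (w 0) = \<zero>\<^bsub>H\<^esub>"
      "p (w 1) = of_real r \<odot>\<^bsub>H\<^esub> v1" "q (w 1) = of_real t \<odot>\<^bsub>H\<^esub> v1"
    using v n by (simp_all add: p_def q_def w_def k_def m_def smult_zero_left smult_one_left)
  define \<beta> :: "('h, 'e) model" where "\<beta> = \<lparr>alice = alice \<alpha>, hilb = plane \<phi>,
    state = (\<lambda>a. \<phi> (w a)), eve = eve \<alpha>, outcomes = outcomes \<alpha>,
    detection = (\<lambda>e j x. \<phi> (compression (detection \<alpha> e j) (coord \<phi> x)))\<rparr>"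
  have "norm (w 0) = 1" "norm (w 1) = 1"
    using n by (simp_all add: w_def norm_prod_def norm_mult power_mult_distrib)
  then have "segmented_model \<beta>"
    using \<phi> complex_hilbert_space_plane[OF \<phi>]
    by (auto simp: segmented_model_def \<beta>_def alice hnorm_plane intro!: povm_compression[OF \<phi> povm])
  moreover have "pr \<beta> j a e = pr \<alpha> j a e"
    if "a \<in> alice \<alpha>" "e \<in> eve \<alpha>" "j \<in> outcomes \<alpha>" for a e j
  proof -
    define T where "T = detection \<alpha> e j"
    have T: "bounded_operator H T"
      using povm that by (simp add: T_def povm_def)
    have "form T (w 0) (w 0) = cinner H v0 (T v0)"
      using v by (simp add: form_def pq cinner_zero_left bounded_operator_closed[OF T])
    \<comment> \<open>The factor \<open>r\<^sup>2 + t\<^sup>2\<close> is the square norm of the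
      qubit vector, hence 1.\<close>
    moreover have "form T (w 1) (w 1) = of_real (r\<^sup>2 + t\<^sup>2) * cinner H v1 (T v1)"
      using v by (simp add: form_def pq bounded_operator_smult[OF T] bounded_operator_closed[OF T]
          cinner_smult_left cinner_smult_right power2_eq_square algebra_simps del: One_nat_def)
    ultimately have "form T (w a) (w a) = cinner H (state \<alpha> a) (T (state \<alpha> a))"
      using that alice t by (auto simp: v0_def v1_def)
    then show ?thesis
      by (simp add: pr_def \<beta>_def \<phi> H_def[symmetric] T_def[symmetric] cprod_inner_compression[OF T])
  qed
  moreover have "cmod (cinner (hilb \<beta>) (state \<beta> 0) (state \<beta> 1)) = r * cmod s"
    using assms \<phi> by (simp add: \<beta>_def w_def cprod_inner_def norm_mult)
  ultimately show ?thesis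
    by (intro exI[of _ \<beta>]) (simp add: \<beta>_def s_def H_def v0_def v1_def)
qed

end
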